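(* Let $f=h+\overline{g}$ be a sense-preserving harmonic function on the unit disk $\mathbb{D}$, where $h,g$ are analytic on $\mathbb{D}$. Then $f$ is univalent and convex in the horizontal direction on $\mathbb{D}$ if and only if the analytic function $h-g$ is univalent and convex in the horizontal direction on $\mathbb{D}$.
   Context: $\mathbb{D}=\{z\in\mathbb{C}:|z|<1\}$. A (complex-valued) harmonic function $f$ on $\mathbb{D}$ can be written $f=h+\overline{g}$ with $h,g$ analytic on $\mathbb{D}$; let $\omega$ be the meromorphic function given by $g'=\omega h'$ (removable singularities of $\omega$ are removed). $f$ is sense-preserving at $z_0\in\mathbb{D}$ if $h'\not\equiv 0$ in some neighborhood of $z_0$ and $\omega$ is analytic at $z_0$ with $|\omega(z_0)|<1$; in particular $h'(z_0)=0$ is allowed. $f$ is sense-preserving in $\mathbb{D}$ if it is sense-preserving at every $z_0\in\mathbb{D}$. (Local univalence of $f$ is not assumed.) Univalent means injective. A univalent function is convex in the horizontal direction on $\mathbb{D}$ if the intersection of its image of $\mathbb{D}$ with every line parallel to the real axis is connected or empty. *)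

theory Defs
  imports "HOL-Complex_Analysis.Complex_Analysis"
begin

abbreviation unit_disk :: "complex set" where
  "unit_disk \<equiv> ball 0 1"

text \<open>
  A complex-valued harmonic function on the unit disk is \<open>f = h + cnj g\<close> with \<open>h\<close>, \<open>g\<close>
  holomorphic. As \<open>h\<close> and \<open>g\<close> are determined by \<open>f\<close> up to additive constants, notions
  that depend only on their derivatives are given as predicates of the pair \<open>h\<close>, \<open>g\<close>.
\<close>

text \<open>
  The meromorphic function \<open>\<omega>\<close> with \<open>g' = \<omega> h'\<close>, its removable singularities
  removed. The value at a pole is \<open>0\<close> (convention of \<^const>\<open>remove_sings\<close>), but the function
  is not analytic there.
\<close>

definition dilatation :: "(complex \<Rightarrow> complex) \<Rightarrow> (complex \<Rightarrow> complex) \<Rightarrow> complex \<Rightarrow> complex" where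
  "dilatation h g = remove_sings (\<lambda>z. deriv g z / deriv h z)"

text \<open>\<open>h'\<close> may vanish at the point itself, but not identically near it.\<close>

definition sense_preserving_at ::
    "(complex \<Rightarrow> complex) \<Rightarrow> (complex \<Rightarrow> complex) \<Rightarrow> complex \<Rightarrow> bool" where
  "sense_preserving_at h g z0 \<longleftrightarrow>
     \<not> (\<forall>\<^sub>F z in nhds z0. deriv h z = 0) \<and>
     dilatation h g analytic_on {z0} \<and>
     cmod (dilatation h g z0) < 1"

definition sense_preserving_on ::
    "(complex \<Rightarrow> complex) \<Rightarrow> (complex \<Rightarrow> complex) \<Rightarrow> complex set \<Rightarrow> bool" where
  "sense_preserving_on h g A \<longleftrightarrow> (\<forall>z0\<in>A. sense_preserving_at h g z0)"

text \<open>The empty set is \<^const>\<open>connected\<close>, so lines missing the image impose no condition.\<close>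

definition convex_horizontal_on :: "(complex \<Rightarrow> complex) \<Rightarrow> complex set \<Rightarrow> bool" where
  "convex_horizontal_on F A \<longleftrightarrow> (\<forall>c. connected (F ` A \<inter> {w. Im w = c}))"

end

theory Submission
  imports Defs
begin

text \<open>
  Write \<open>\<phi> = h - g\<close>. Since \<open>f = \<phi> + 2 Re g\<close>, the functions \<open>f\<close> and \<open>\<phi>\<close> have the
  same imaginary part: passing from one to the other moves points only along horizontal lines.
  So if one of them, \<open>F\<close>, is univalent and convex in the horizontal direction, then the
  other, \<open>G\<close>, factors as \<open>G = (G \<circ> F\<^sup>-\<^sup>1) \<circ> F\<close>, where \<open>G \<circ> F\<^sup>-\<^sup>1\<close> maps each
  horizontal slice of the image of \<open>F\<close>, which is an interval, continuously into the same
  line. If these real functions of one variable are strictly increasing, then \<open>G\<close> is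
  univalent, and its slices are continuous images of intervals, hence connected
  (\<open>univalent_convex_horizontal_transfer\<close>).

  Monotonicity comes from the sign of a derivative. In a direction \<open>\<zeta> \<noteq> 0\<close> along
  which the imaginary parts are stationary, the derivatives of \<open>f\<close> and \<open>\<phi>\<close> are real and
  their product is \<open>(Re (h' \<zeta>))\<^sup>2 - (Re (g' \<zeta>))\<^sup>2\<close>. As \<open>h' \<zeta>\<close> and \<open>g' \<zeta>\<close>
  then have equal imaginary parts, this is \<open>(\<bar>h'\<bar>\<^sup>2 - \<bar>g'\<bar>\<^sup>2) \<bar>\<zeta>\<bar>\<^sup>2\<close>, which is positive
  where \<open>h' \<noteq> 0\<close>, because \<open>f\<close> is sense-preserving (\<open>shear_same_sign\<close>). This relation is
  symmetric in \<open>f\<close> and \<open>\<phi>\<close>, so one argument gives both implications.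

  The zeros of \<open>h'\<close> are isolated, so only finitely many lie over a compact segment, and finitely
  many exceptional points do not affect strict monotonicity of a continuous function.
  Continuity of \<open>F\<^sup>-\<^sup>1\<close> is invariance of domain.
\<close>

section \<open>Functions with equal imaginary parts\<close>

lemma positive_derivative_off_finite_imp_less:
  fixes \<psi> :: "real \<Rightarrow> real"
  assumes "finite T" "a < b" "continuous_on {a..b} \<psi>"
    and "\<And>x. a < x \<Longrightarrow> x < b \<Longrightarrow> x \<notin> T \<Longrightarrow> \<exists>y. DERIV \<psi> x :> y \<and> y > 0"
  shows "\<psi> a < \<psi> b"
  using assms
proof (induction T arbitrary: a b rule: finite_induct)
  case empty
  then show ?case
    by (intro DERIV_pos_imp_increasing_open[of a b \<psi>]) auto
next
  case (insert t T)
  show ?case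
  proof (cases "a < t \<and> t < b")
    case True
    have "\<psi> a < \<psi> t"
      by (rule insert.IH) (use True insert.prems in \<open>auto intro: continuous_on_subset\<close>)
    moreover have "\<psi> t < \<psi> b"
      by (rule insert.IH) (use True insert.prems in \<open>auto intro: continuous_on_subset\<close>)
    ultimately show ?thesis by linarith
  next
    case False
    show ?thesis
      by (rule insert.IH) (use False insert.prems in auto)
  qed
qed

text \<open>A slice projects homeomorphically to a connected subset of the real line, an interval.\<close>

lemma horizontal_segment_in_image:
  assumes "convex_horizontal_on F S"
    and "Complex u v \<in> F ` S" "Complex u' v \<in> F ` S" "u \<le> t" "t \<le> u'"
  shows "Complex t v \<in> F ` S"
proof -
  let ?L = "F ` S \<inter> {w. Im w = v}"
  have "connected (Re ` ?L)"
    using assms(1) unfolding convex_horizontal_on_def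
    by (intro connected_continuous_image continuous_intros) auto
  moreover have "u \<in> Re ` ?L" "u' \<in> Re ` ?L"
    using assms(2,3) rev_image_eqI[of "Complex u v" ?L u Re]
      rev_image_eqI[of "Complex u' v" ?L u' Re] by auto
  ultimately have "t \<in> Re ` ?L"
    using assms(4,5) connected_contains_Icc[of "Re ` ?L" u u'] by auto
  then obtain w where "w \<in> F ` S" "Im w = v" "t = Re w" by blast
  then show ?thesis by (metis complex_surj)
qed

text \<open>
  The derivative condition says that \<open>G \<circ> F\<^sup>-\<^sup>1\<close> increases along horizontal lines: if
  \<open>\<zeta>\<close> is the velocity of \<open>F\<^sup>-\<^sup>1\<close> when the image point moves to the right at unit speed,
  then \<open>A \<zeta> = 1\<close>, and \<open>Re (B \<zeta>)\<close> is the resulting horizontal speed of \<open>G\<close>. The set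
  \<open>Z\<close> makes room for critical points. In the application \<open>F\<close>, \<open>G\<close> are
  \<open>f\<close>, \<open>h - g\<close> in either order.
\<close>

lemma univalent_convex_horizontal_transfer:
  fixes F G :: "complex \<Rightarrow> complex"
  assumes "open S" and contF: "continuous_on S F" and contG: "continuous_on S G"
    and Im_eq: "\<And>z. z \<in> S \<Longrightarrow> Im (G z) = Im (F z)"
    and injF: "inj_on F S" and chd: "convex_horizontal_on F S"
    and fin: "\<And>K. compact K \<Longrightarrow> K \<subseteq> S \<Longrightarrow> finite (K \<inter> Z)"
    and der: "\<And>z. z \<in> S - Z \<Longrightarrow> \<exists>A B. (F has_derivative A) (at z) \<and>
                (G has_derivative B) (at z) \<and> inj A \<and> (\<forall>\<zeta>. A \<zeta> = 1 \<longrightarrow> 0 < Re (B \<zeta>))"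
  shows "inj_on G S \<and> convex_horizontal_on G S"
proof -
  obtain k where hom: "homeomorphism S (F ` S) F k"
    using invariance_of_domain_homeomorphism[OF \<open>open S\<close> contF _ injF] by auto
  have kF: "k (F z) = z" if "z \<in> S" for z
    using hom that by (simp add: homeomorphism_def)
  have Fk: "F (k w) = w" and kS: "k w \<in> S" if "w \<in> F ` S" for w
    using hom that by (auto simp: homeomorphism_def)
  have contk: "continuous_on (F ` S) k"
    using hom by (simp add: homeomorphism_def)
  have contGk: "continuous_on (F ` S) (\<lambda>w. G (k w))"
    by (rule continuous_on_compose2[OF contG contk]) (use kS in auto)

  have less: "Re (G (k (Complex u v))) < Re (G (k (Complex u' v)))"
    if "u < u'" "Complex u v \<in> F ` S" "Complex u' v \<in> F ` S" for u u' v
  proof -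
    let ?c = "\<lambda>t. Complex t v"
    have c_eq: "?c = (\<lambda>t. of_real t + \<i> * of_real v)"
      by (auto simp: complex_eq_iff)
    have seg: "?c t \<in> F ` S" if "t \<in> {u..u'}" for t
      using horizontal_segment_in_image[OF chd \<open>?c u \<in> _\<close> \<open>?c u' \<in> _\<close>] that by simp
    have contc: "continuous_on A ?c" for A
      unfolding c_eq by (intro continuous_intros)
    have contkc: "continuous_on {u..u'} (\<lambda>t. k (?c t))"
      by (rule continuous_on_compose2[OF contk contc]) (use seg in auto)
    define T where "T = {t \<in> {u..u'}. k (?c t) \<in> Z}"
    \<comment> \<open>The pullback of the segment is a compact arc, traversed injectively.\<close>
    have "finite T"
    proof (rule finite_imageD)
      have "finite (((\<lambda>t. k (?c t)) ` {u..u'}) \<inter> Z)"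
        by (rule fin) (use contkc seg kS in \<open>auto intro!: compact_continuous_image\<close>)
      then show "finite ((\<lambda>t. k (?c t)) ` T)"
        by (rule rev_finite_subset) (auto simp: T_def)
      show "inj_on (\<lambda>t. k (?c t)) T"
        by (rule inj_onI) (metis (no_types, lifting) Fk seg T_def mem_Collect_eq complex.sel(1))
    qed
    show ?thesis
    proof (rule positive_derivative_off_finite_imp_less[OF \<open>finite T\<close> \<open>u < u'\<close>,
          where \<psi> = "\<lambda>t. Re (G (k (?c t)))"])
      show "continuous_on {u..u'} (\<lambda>t. Re (G (k (?c t))))"
        by (intro continuous_on_Re continuous_on_compose2[OF contGk contc]) (use seg in auto)
    next
      fix t assume t: "u < t" "t < u'" "t \<notin> T"
      define z where "z = k (?c t)"
      have ct: "?c t \<in> F ` S" using seg t by simp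
      have z: "z \<in> S - Z" using t kS[OF ct] by (auto simp: T_def z_def)
      then obtain A B where A: "(F has_derivative A) (at z)" and B: "(G has_derivative B) (at z)"
        and injA: "inj A" and pos: "\<And>\<zeta>. A \<zeta> = 1 \<Longrightarrow> 0 < Re (B \<zeta>)"
        using der by blast
      have linA: "linear A" using A by (rule has_derivative_linear)
      then have "surj A" using injA by (rule linear_injective_imp_surjective) simp
      then obtain A' where linA': "linear A'" and AA': "A \<circ> A' = id"
        using linear_surjective_right_inverse[OF linA] by blast
      \<comment> \<open>The inverse is already known to be continuous, so a right inverse of the derivative at
        the single point \<open>z\<close> suffices to differentiate it.\<close>
      have "(k has_derivative A') (at (F z))"
        by (rule has_derivative_inverse_strong[OF \<open>open S\<close> _ contF _ A AA'])
          (use z kF in auto)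
      then have k': "(k has_derivative A') (at (?c t))"
        using Fk[OF ct] by (simp add: z_def)
      have c': "(?c has_derivative (\<lambda>s. of_real s)) (at t)"
        unfolding c_eq by (auto intro!: derivative_eq_intros)
      have "((\<lambda>t. G (k (?c t))) has_derivative (\<lambda>s. B (A' (of_real s)))) (at t)"
        using has_derivative_compose[OF has_derivative_compose[OF c' k'] B[unfolded z_def]] .
      then have d: "((\<lambda>t. Re (G (k (?c t)))) has_derivative (\<lambda>s. Re (B (A' (of_real s))))) (at t)"
        by (rule has_derivative_Re)
      have "linear B" using B by (rule has_derivative_linear)
      then have "Re (B (A' (of_real s))) = Re (B (A' 1)) * s" for s
        using linear_scale[OF linA', of s 1] linear_scale[of B s "A' 1"]
        by (simp add: scaleR_conv_of_real)
      with d have "DERIV (\<lambda>t. Re (G (k (?c t)))) t :> Re (B (A' 1))"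
        by (simp add: has_field_derivative_def)
      moreover have "A (A' 1) = 1" using AA' by (simp add: fun_eq_iff)
      ultimately show "\<exists>y. DERIV (\<lambda>t. Re (G (k (?c t)))) t :> y \<and> y > 0"
        using pos by blast
    qed
  qed

  have "inj_on G S"
  proof (rule inj_onI)
    fix z1 z2 assume z: "z1 \<in> S" "z2 \<in> S" "G z1 = G z2"
    then have Im: "Im (F z1) = Im (F z2)" using Im_eq by metis
    have "\<not> Re (F x) < Re (F y)"
      if "x \<in> S" "y \<in> S" "G x = G y" "Im (F x) = Im (F y)" for x y
    proof -
      have "Complex (Re (F x)) (Im (F y)) = F x" "Complex (Re (F y)) (Im (F y)) = F y"
        using that(4) by (simp_all add: complex_eq_iff)
      then show ?thesis
        using less[of "Re (F x)" "Re (F y)" "Im (F y)"] that(1-3) kF by auto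
    qed
    then have "Re (F z1) = Re (F z2)" using z Im by (metis linorder_less_linear)
    with Im have "F z1 = F z2" by (simp add: complex_eq_iff)
    with z injF show "z1 = z2" by (auto dest: inj_onD)
  qed
  moreover have "convex_horizontal_on G S"
    unfolding convex_horizontal_on_def
  proof
    fix c
    have "G ` S \<inter> {w. Im w = c} = (\<lambda>w. G (k w)) ` (F ` S \<inter> {w. Im w = c})"
      using Im_eq kF by (force simp: image_iff)
    moreover have "connected \<dots>"
      using chd unfolding convex_horizontal_on_def
      by (intro connected_continuous_image continuous_on_subset[OF contGk]) auto
    ultimately show "connected (G ` S \<inter> {w. Im w = c})" by simp
  qed
  ultimately show ?thesis ..
qed

section \<open>The shear of a sense-preserving harmonic function\<close>

text \<open>
  With \<open>a = h'\<close> and \<open>b = g'\<close> the two factors are the directional derivatives of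
  \<open>Re f\<close> and \<open>Re (h - g)\<close>. They are \<open>Re (a \<zeta>) + Re (b \<zeta>)\<close> and \<open>Re (a \<zeta>) - Re (b \<zeta>)\<close>,
  so the product is a difference of squares; equality of the imaginary parts of \<open>a \<zeta>\<close> and
  \<open>b \<zeta>\<close> turns the inequality of moduli into one of real parts.
\<close>

lemma shear_same_sign:
  fixes a b \<zeta> :: complex
  assumes "cmod b < cmod a" "\<zeta> \<noteq> 0" and real: "Im ((a - b) * \<zeta>) = 0"
  shows "Re (a * \<zeta> + cnj (b * \<zeta>)) * Re ((a - b) * \<zeta>) > 0"
proof -
  have "cmod (b * \<zeta>) < cmod (a * \<zeta>)"
    using assms by (simp add: norm_mult)
  then have "(cmod (b * \<zeta>))\<^sup>2 < (cmod (a * \<zeta>))\<^sup>2"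
    by (simp add: power_strict_mono)
  moreover have "Im (a * \<zeta>) = Im (b * \<zeta>)" using real by (simp add: algebra_simps)
  ultimately have "(Re (b * \<zeta>))\<^sup>2 < (Re (a * \<zeta>))\<^sup>2"
    by (simp only: cmod_power2)
  moreover have "Re (a * \<zeta> + cnj (b * \<zeta>)) * Re ((a - b) * \<zeta>)
      = (Re (a * \<zeta>))\<^sup>2 - (Re (b * \<zeta>))\<^sup>2"
    by (simp add: left_diff_distrib power2_eq_square algebra_simps)
  ultimately show ?thesis by linarith
qed

text \<open>Where \<open>h'\<close> does not vanish, the dilatation is the plain quotient \<open>g' / h'\<close>.\<close>

lemma sense_preserving_at_imp_deriv_less:
  assumes "h holomorphic_on S" "g holomorphic_on S" "open S" "z \<in> S"
    and "sense_preserving_at h g z" "deriv h z \<noteq> 0"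
  shows "cmod (deriv g z) < cmod (deriv h z)"
proof -
  have "h analytic_on {z}" "g analytic_on {z}"
    using assms analytic_at by blast+
  then have "(\<lambda>z. deriv g z / deriv h z) analytic_on {z}"
    using assms by (intro analytic_intros) auto
  then have "dilatation h g z = deriv g z / deriv h z"
    unfolding dilatation_def by (rule remove_sings_at_analytic)
  with assms show ?thesis
    by (simp add: sense_preserving_at_def norm_divide divide_simps)
qed

theorem theorem2:
  fixes f h g :: "complex \<Rightarrow> complex"
  assumes "h holomorphic_on unit_disk"
    and "g holomorphic_on unit_disk"
    and "\<forall>z\<in>unit_disk. f z = h z + cnj (g z)"
    and "sense_preserving_on h g unit_disk"
  shows "(inj_on f unit_disk \<and> convex_horizontal_on f unit_disk) \<longleftrightarrow>
         (inj_on (\<lambda>z. h z - g z) unit_disk \<and>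
          convex_horizontal_on (\<lambda>z. h z - g z) unit_disk)"
proof -
  define Z where "Z = {z. deriv h z = 0}"
  let ?A = "\<lambda>z \<zeta>. deriv h z * \<zeta> + cnj (deriv g z * \<zeta>)"
  let ?B = "\<lambda>z \<zeta>. (deriv h z - deriv g z) * \<zeta>"
  let ?\<phi> = "\<lambda>z. h z - g z"
  have h': "(h has_field_derivative deriv h z) (at z)"
    and g': "(g has_field_derivative deriv g z) (at z)" if "z \<in> unit_disk" for z
    using assms(1,2) that by (auto intro: holomorphic_derivI[OF _ open_ball])
  have df: "(f has_derivative ?A z) (at z)" if "z \<in> unit_disk" for z
  proof (rule has_derivative_transform_within_open[OF _ open_ball that])
    show "((\<lambda>z. h z + cnj (g z)) has_derivative ?A z) (at z)"
      using h'[OF that] g'[OF that] unfolding has_field_derivative_def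
      by (intro has_derivative_add has_derivative_cnj)
  qed (use assms(3) in auto)
  have d\<phi>: "(?\<phi> has_derivative ?B z) (at z)" if "z \<in> unit_disk" for z
    using DERIV_diff[OF h'[OF that] g'[OF that]] unfolding has_field_derivative_def .
  have contf: "continuous_on unit_disk f" and cont\<phi>: "continuous_on unit_disk ?\<phi>"
    using df d\<phi> by (meson continuous_at_imp_continuous_on has_derivative_continuous)+
  have Im_eq: "Im (f z) = Im (?\<phi> z)" if "z \<in> unit_disk" for z
    using assms(3) that by simp
  have fin: "finite (K \<inter> Z)" if "compact K" "K \<subseteq> unit_disk" for K
  proof -
    have "\<not> (\<forall>\<^sub>F z in nhds 0. deriv h z = 0)"
      using assms(4) by (simp add: sense_preserving_on_def sense_preserving_at_def)
    then obtain w where w: "w \<in> unit_disk" "deriv h w \<noteq> 0"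
      unfolding eventually_nhds by (metis centre_in_ball open_ball zero_less_one)
    have "finite {z \<in> K. deriv h z = 0}"
    proof (cases "deriv h constant_on unit_disk")
      case True
      with w \<open>K \<subseteq> unit_disk\<close> have "{z \<in> K. deriv h z = 0} = {}"
        by (auto simp: constant_on_def)
      then show ?thesis by (simp only: finite.emptyI)
    next
      case False
      then show ?thesis
        using that assms(1)
        by (intro holomorphic_compact_finite_zeros[of "deriv h" unit_disk K])
          (auto intro: holomorphic_deriv)
    qed
    then show ?thesis by (simp add: Z_def Int_def)
  qed
  have less: "cmod (deriv g z) < cmod (deriv h z)" if "z \<in> unit_disk - Z" for z
    using that assms(4)
    by (intro sense_preserving_at_imp_deriv_less[OF assms(1,2) open_ball])
       (auto simp: Z_def sense_preserving_on_def)
  have Im_AB: "Im (?A z \<zeta>) = Im (?B z \<zeta>)" for z \<zeta>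
    by (simp add: algebra_simps)
  have sgn: "Re (?A z \<zeta>) * Re (?B z \<zeta>) > 0"
    if "z \<in> unit_disk - Z" "\<zeta> \<noteq> 0" "Im (?B z \<zeta>) = 0" for z \<zeta>
    using shear_same_sign[OF less[OF that(1)] that(2,3)] .
  have injA: "inj (?A z)" and injB: "inj (?B z)" if z: "z \<in> unit_disk - Z" for z
  proof -
    have nonzero: "?A z \<zeta> \<noteq> 0 \<and> ?B z \<zeta> \<noteq> 0" if "\<zeta> \<noteq> 0" for \<zeta>
    proof (rule ccontr)
      assume "\<not> (?A z \<zeta> \<noteq> 0 \<and> ?B z \<zeta> \<noteq> 0)"
      then consider "?A z \<zeta> = 0" | "?B z \<zeta> = 0" by blast
      then show False
      proof cases
        case 1
        have "Im (?B z \<zeta>) = 0" using Im_AB[of z \<zeta>, unfolded 1] by simp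
        from sgn[OF z that this, unfolded 1] show False by simp
      next
        case 2
        have "Im (?B z \<zeta>) = 0" unfolding 2 by simp
        from sgn[OF z that this, unfolded 2] show False by simp
      qed
    qed
    have "z \<in> unit_disk" using z by (rule DiffD1)
    show "inj (?A z)"
      unfolding linear_injective_0[OF has_derivative_linear[OF df[OF \<open>z \<in> unit_disk\<close>]]]
      using nonzero by blast
    show "inj (?B z)"
      unfolding linear_injective_0[OF has_derivative_linear[OF d\<phi>[OF \<open>z \<in> unit_disk\<close>]]]
      using nonzero by blast
  qed
  show ?thesis
  proof
    assume f: "inj_on f unit_disk \<and> convex_horizontal_on f unit_disk"
    show "inj_on ?\<phi> unit_disk \<and> convex_horizontal_on ?\<phi> unit_disk"
    proof (rule univalent_convex_horizontal_transfer[OF open_ball contf cont\<phi>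
          Im_eq[symmetric] conjunct1[OF f] conjunct2[OF f] fin])
      fix z assume z: "z \<in> unit_disk - Z"
      have "0 < Re (?B z \<zeta>)" if 1: "?A z \<zeta> = 1" for \<zeta>
      proof -
        have "\<zeta> \<noteq> 0" "Im (?B z \<zeta>) = 0"
          using 1 Im_AB[of z \<zeta>, unfolded 1] by auto
        from sgn[OF z this, unfolded 1] show ?thesis by simp
      qed
      then show "\<exists>A B. (f has_derivative A) (at z) \<and> (?\<phi> has_derivative B) (at z) \<and>
          inj A \<and> (\<forall>\<zeta>. A \<zeta> = 1 \<longrightarrow> 0 < Re (B \<zeta>))"
        using df[OF DiffD1[OF z]] d\<phi>[OF DiffD1[OF z]] injA[OF z]
        by (intro exI[of _ "?A z"] exI[of _ "?B z"] conjI allI impI)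
    qed
  next
    assume \<phi>: "inj_on ?\<phi> unit_disk \<and> convex_horizontal_on ?\<phi> unit_disk"
    show "inj_on f unit_disk \<and> convex_horizontal_on f unit_disk"
    proof (rule univalent_convex_horizontal_transfer[OF open_ball cont\<phi> contf
          Im_eq conjunct1[OF \<phi>] conjunct2[OF \<phi>] fin])
      fix z assume z: "z \<in> unit_disk - Z"
      have "0 < Re (?A z \<zeta>)" if 1: "?B z \<zeta> = 1" for \<zeta>
      proof -
        have "\<zeta> \<noteq> 0" "Im (?B z \<zeta>) = 0" using 1 by auto
        from sgn[OF z this, unfolded 1] show ?thesis by simp
      qed
      then show "\<exists>A B. (?\<phi> has_derivative A) (at z) \<and> (f has_derivative B) (at z) \<and>
          inj A \<and> (\<forall>\<zeta>. A \<zeta> = 1 \<longrightarrow> 0 < Re (B \<zeta>))"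
        using df[OF DiffD1[OF z]] d\<phi>[OF DiffD1[OF z]] injB[OF z]
        by (intro exI[of _ "?B z"] exI[of _ "?A z"] conjI allI impI)
    qed
  qed
qed

end
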